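(* Let $D\ge 1$, let $\vec w_1,\dots,\vec w_n\in\mathbb{R}^{D+1}$, and let $C=\mathrm{cone}(\{\vec w_i\}_{i=1}^n)$ be the cone they generate, where $C$ has dimension $D+1$. Let $G$ be a real matrix with $D+1$ columns, let $\vec b_C\in\mathbb{R}^{D+1}$ be a facet-normal vector of $C$ satisfying $G\vec b_C=0$, and let $K=\dim\ker G$. Let $\vec t_1,\dots,\vec t_K$ be a basis of $\ker G$, let $T$ be the $(D+1)\times K$ matrix whose columns are $\vec t_1,\dots,\vec t_K$, and let $\vec b_{\tilde C}\in\mathbb{R}^K$ be the (unique) vector with $\vec b_C=T\vec b_{\tilde C}$. Define $\tilde{\vec w}_i\in\mathbb{R}^K$ by $\tilde{\vec w}_i^{\,T}=\vec w_i^{\,T}T$ for $i=1,\dots,n$, and let $\tilde C=\mathrm{cone}(\{\tilde{\vec w}_i\}_{i=1}^n)\subseteq\mathbb{R}^K$, a cone of dimension $K$. Then $\vec b_{\tilde C}$ defines a facet of $\tilde C$, i.e. $\vec b_{\tilde C}$ is a facet-normal vector of $\tilde C$.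
   Context: For a finite set $V$ of vectors, $\mathrm{cone}(V)$ is the set of all linear combinations of elements of $V$ with nonnegative coefficients. The dimension of a cone is the dimension of its linear span. For a cone $C\subseteq\mathbb{R}^m$ of dimension $m$, a vector $\vec b\in\mathbb{R}^m$ is a facet-normal vector of $C$ (equivalently, $\vec b$ defines a facet of $C$) if $\vec b\neq 0$, $\vec x^T\vec b\ge 0$ for all $\vec x\in C$, and the face $\{\vec x\in C:\vec x^T\vec b=0\}$ has dimension $m-1$. *)

theory Defs
  imports "HOL-Analysis.Analysis"
begin

definition cone_gen :: "'a::real_vector set \<Rightarrow> 'a set" where
  "cone_gen V = {\<Sum>v\<in>V. c v *\<^sub>R v | c. \<forall>v\<in>V. 0 \<le> c v}"

lemma cone_gen_eq_convex_cone_hull: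
  assumes "finite V"
  shows "cone_gen V = convex_cone hull V"
proof
  show "cone_gen V \<subseteq> convex_cone hull V"
  proof
    fix x assume "x \<in> cone_gen V"
    then obtain c where c: "\<forall>v\<in>V. 0 \<le> c v" and x: "x = (\<Sum>v\<in>V. c v *\<^sub>R v)"
      unfolding cone_gen_def by blast
    have "(\<Sum>v\<in>W. c v *\<^sub>R v) \<in> convex_cone hull V" if "W \<subseteq> V" for W
      using finite_subset[OF that assms] that
    proof (induction W rule: finite_induct)
      case empty
      then show ?case by (simp add: convex_cone_hull_contains_0)
    next
      case (insert v W)
      then show ?case
        using c by (simp add: convex_cone_hull_add convex_cone_hull_mul hull_inc)
    qed
    then show "x \<in> convex_cone hull V" using x by blast
  qed
  have "V \<subseteq> cone_gen V"
  proof
    fix x assume "x \<in> V"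
    then have "x = (\<Sum>v\<in>V. (if v = x then 1 else 0) *\<^sub>R v)"
      using assms by (simp add: if_distrib[of "\<lambda>r. r *\<^sub>R _"] cong: if_cong)
    moreover have "\<forall>v\<in>V. 0 \<le> (if v = x then 1 else 0 :: real)" by simp
    ultimately show "x \<in> cone_gen V"
      unfolding cone_gen_def by (intro CollectI exI[of _ "\<lambda>v. if v = x then 1 else 0"] conjI)
  qed
  moreover have "convex_cone (cone_gen V)"
    unfolding convex_cone_iff
  proof (intro conjI ballI allI impI)
    show "0 \<in> cone_gen V"
      unfolding cone_gen_def by (intro CollectI exI[of _ "\<lambda>_. 0"]) simp
  next
    fix x y assume "x \<in> cone_gen V" "y \<in> cone_gen V"
    then obtain c d where "\<forall>v\<in>V. 0 \<le> c v" "x = (\<Sum>v\<in>V. c v *\<^sub>R v)"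
      and "\<forall>v\<in>V. 0 \<le> d v" "y = (\<Sum>v\<in>V. d v *\<^sub>R v)"
      unfolding cone_gen_def by blast
    then show "x + y \<in> cone_gen V"
      unfolding cone_gen_def
      by (intro CollectI exI[of _ "\<lambda>v. c v + d v"]) (simp add: scaleR_left_distrib sum.distrib)
  next
    fix x and a :: real assume "x \<in> cone_gen V" "0 \<le> a"
    then obtain c where "\<forall>v\<in>V. 0 \<le> c v" "x = (\<Sum>v\<in>V. c v *\<^sub>R v)"
      unfolding cone_gen_def by blast
    then show "a *\<^sub>R x \<in> cone_gen V"
      unfolding cone_gen_def using \<open>0 \<le> a\<close>
      by (intro CollectI exI[of _ "\<lambda>v. a * c v"]) (simp add: scaleR_sum_right)
  qed
  ultimately show "convex_cone hull V \<subseteq> cone_gen V"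
    by (simp add: hull_minimal)
qed

text \<open>The library's \<open>dim S\<close> is the dimension of the linear span of \<open>S\<close>. The notion below is
  meant for cones \<open>C\<close> with \<open>dim C = CARD('m)\<close>; it does not itself assert this.\<close>

definition facet_normal :: "(real ^ 'm) set \<Rightarrow> real ^ 'm \<Rightarrow> bool" where
  "facet_normal C b \<longleftrightarrow>
     b \<noteq> 0 \<and> (\<forall>x\<in>C. 0 \<le> x \<bullet> b) \<and> dim {x \<in> C. x \<bullet> b = 0} = CARD('m) - 1"

end

theory Submission
  imports Defs
begin

text \<open>Put \<open>f x = T\<^sup>T x\<close>. Since \<open>T\<close> has independent columns, \<open>f\<close> is onto, and it maps \<open>C\<close> onto the
  projected cone. As \<open>f x \<bullet> bt = x \<bullet> T bt = x \<bullet> b\<^sub>C\<close>, it maps the facet of \<open>C\<close> onto the corresponding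
  face, and the hyperplane orthogonal to \<open>b\<^sub>C\<close>, which is the span of that facet, onto the hyperplane
  orthogonal to \<open>bt\<close>.\<close>

lemma cone_gen_linear_image:
  assumes "linear f" and "finite V"
  shows "cone_gen (f ` V) = f ` cone_gen V"
  using assms by (simp add: cone_gen_eq_convex_cone_hull convex_cone_hull_linear_image)

text \<open>Full dimension means spanning the whole space, and a surjective linear map sends
  spanning sets to spanning sets.\<close>

lemma dim_linear_surj_image_full:
  fixes f :: "'a::euclidean_space \<Rightarrow> 'b::euclidean_space"
  assumes "linear f" and "surj f" and "dim S = DIM('a)"
  shows "dim (f ` S) = DIM('b)"
proof -
  have "span S = UNIV"
    using assms(3) by (simp add: dim_eq_full)
  then have "span (f ` S) = UNIV"
    using assms(1,2) by (simp add: linear_span_image)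
  then show ?thesis
    by (simp add: dim_eq_full)
qed

text \<open>The face lies in the hyperplane, and since \<open>b\<close> is nonzero both have
  dimension \<open>CARD('m) - 1\<close>, so the inclusion of subspaces is an equality.\<close>

lemma facet_normal_span_face:
  fixes C :: "(real ^ 'm) set"
  assumes "facet_normal C b"
  shows "span {x \<in> C. x \<bullet> b = 0} = {x. b \<bullet> x = 0}"
proof -
  have "span {x \<in> C. x \<bullet> b = 0} \<subseteq> {x. b \<bullet> x = 0}"
    by (rule span_minimal) (auto simp: inner_commute[of b] subspace_hyperplane2)
  then show ?thesis
    using assms
    by (intro subspace_dim_equal) (auto simp: subspace_hyperplane facet_normal_def dim_hyperplane)
qed

text \<open>The condition \<open>adj\<close> says that the adjoint of \<open>f\<close> sends
  \<open>b'\<close> to \<open>b\<close>; this is all that is used of the relation between the two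
  normals.\<close>

lemma facet_normal_surj_image:
  fixes f :: "real ^ 'm \<Rightarrow> real ^ 'k"
  assumes f: "linear f" "surj f"
    and adj: "\<And>x. f x \<bullet> b' = x \<bullet> b"
    and b: "facet_normal C b"
  shows "facet_normal (f ` C) b'"
proof -
  have "b \<noteq> 0" and pos: "\<And>x. x \<in> C \<Longrightarrow> 0 \<le> x \<bullet> b"
    using b by (auto simp: facet_normal_def)
  \<comment> \<open>At \<open>x = b\<close> the right side of \<open>adj\<close> is
    \<open>b \<bullet> b\<close>, which is positive.\<close>
  have "b' \<noteq> 0"
    using adj[of b] \<open>b \<noteq> 0\<close> by auto
  have "{y \<in> f ` C. y \<bullet> b' = 0} = f ` {x \<in> C. x \<bullet> b = 0}"
    using adj by auto
  then have "span {y \<in> f ` C. y \<bullet> b' = 0} = f ` {x. b \<bullet> x = 0}"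
    by (simp add: linear_span_image f(1) facet_normal_span_face[OF b])
  also have "\<dots> = {y. b' \<bullet> y = 0}"
  proof
    show "f ` {x. b \<bullet> x = 0} \<subseteq> {y. b' \<bullet> y = 0}"
      using adj by (auto simp: inner_commute)
    show "{y. b' \<bullet> y = 0} \<subseteq> f ` {x. b \<bullet> x = 0}"
    proof
      fix y assume "y \<in> {y. b' \<bullet> y = 0}"
      moreover obtain x where "y = f x"
        using f(2) by blast
      ultimately show "y \<in> f ` {x. b \<bullet> x = 0}"
        using adj[of x] by (auto simp: inner_commute)
    qed
  qed
  finally have "dim {y \<in> f ` C. y \<bullet> b' = 0} = CARD('k) - 1"
    using dim_span[of "{y \<in> f ` C. y \<bullet> b' = 0}"] \<open>b' \<noteq> 0\<close> by (simp add: dim_hyperplane)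
  moreover have "\<forall>y\<in>f ` C. 0 \<le> y \<bullet> b'"
    using adj pos by simp
  ultimately show ?thesis
    using \<open>b' \<noteq> 0\<close> by (simp only: facet_normal_def simp_thms)
qed

theorem theorem1:
  fixes D n K :: nat
    and w :: "nat \<Rightarrow> real ^ 'd"
    and C :: "(real ^ 'd) set"
    and G :: "real ^ 'd ^ 'r"
    and b\<^sub>C :: "real ^ 'd"
    and t :: "'k::finite \<Rightarrow> real ^ 'd"
    and T :: "real ^ 'k ^ 'd"
    and bt :: "real ^ 'k"
    and wt :: "nat \<Rightarrow> real ^ 'k"
    and Ct :: "(real ^ 'k) set"
  assumes "D \<ge> 1" and "CARD('d) = D + 1"
    and "C = cone_gen (w ` {1..n})"
    and "dim C = D + 1"
    and "facet_normal C b\<^sub>C"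
    and "G *v b\<^sub>C = 0"
    and "K = dim {x. G *v x = 0}" and "CARD('k) = K"
    and "inj t" and "independent (range t)" and "span (range t) = {x. G *v x = 0}"
    and "\<And>j. column j T = t j"
    and "bt = (THE b. b\<^sub>C = T *v b)"
    and "\<And>i. i \<in> {1..n} \<Longrightarrow> wt i = w i v* T"
    and "Ct = cone_gen (wt ` {1..n})"
  shows "(\<exists>!b. b\<^sub>C = T *v b) \<and> dim Ct = K \<and> facet_normal Ct bt"
proof -
  have cols: "columns T = range t"
    using assms(12) by (auto simp: columns_def)
  \<comment> \<open>The columns are distinct and independent. Full column rank makes
    \<open>T\<close> injective and its transpose surjective.\<close>
  have rank: "rank T = CARD('k)"
    using assms(9,10) cols by (simp add: column_rank_def dim_eq_card_independent card_image)
  have inj: "inj ((*v) T)"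
    using rank by (simp add: full_rank_injective)
  have "surj ((*v) (transpose T))"
    using rank by (simp only: full_rank_surjective[symmetric] rank_transpose)
  then have surj: "surj (\<lambda>x. x v* T)"
    by simp
  have lin: "linear (\<lambda>x. x v* T)"
    using matrix_vector_mul_linear[of "transpose T"] by simp
  have "b\<^sub>C \<in> span (columns T)"
    using assms(6,11) cols by simp
  \<comment> \<open>Each column is the image under \<open>T\<close> of a standard basis
    vector.\<close>
  moreover have "span (columns T) \<subseteq> range ((*v) T)"
  proof (rule span_minimal)
    show "columns T \<subseteq> range ((*v) T)"
      by (auto simp: columns_def simp flip: matrix_vector_mult_basis)
    show "subspace (range ((*v) T))"
      by (rule linear_subspace_image[OF matrix_vector_mul_linear subspace_UNIV])
  qed
  ultimately have "b\<^sub>C \<in> range ((*v) T)"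
    by blast
  then have ex1: "\<exists>!b. b\<^sub>C = T *v b"
    using inj by (metis (mono_tags) injD rangeE)
  \<comment> \<open>The definite description for \<open>bt\<close> is meaningful only because of
    \<open>ex1\<close>.\<close>
  then have bt: "b\<^sub>C = T *v bt"
    unfolding assms(13) by (rule theI')
  have "wt ` {1..n} = (\<lambda>x. x v* T) ` w ` {1..n}"
    using assms(14) by (auto simp: image_image intro!: image_cong)
  then have Ct: "Ct = (\<lambda>x. x v* T) ` C"
    by (simp only: assms(3,15) cone_gen_linear_image[OF lin] finite_imageI finite_atLeastAtMost)
  have "dim Ct = K"
    using dim_linear_surj_image_full[OF lin surj, of C] assms(2,4,8) Ct by simp
  \<comment> \<open>The premise left open is \<open>adj\<close>: moving \<open>T\<close> across the
    inner product turns \<open>bt\<close> into \<open>T *v bt\<close>, that is,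
    \<open>b\<^sub>C\<close>.\<close>
  moreover have "facet_normal Ct bt"
    unfolding Ct using lin surj _ assms(5)
    by (rule facet_normal_surj_image) (simp add: dot_lmul_matrix bt)
  ultimately show ?thesis
    using ex1 by blast
qed

end
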